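(* Let $A_1,\dots,A_m\in\mathbb{R}^{n\times n}$ ($m\ge 1$) be symmetric matrices, and consider the problem, in the variables $(x,z)\in\mathbb{R}^n\times\mathbb{R}$, of minimizing $z$ subject to $g_i(x,z):=\frac12 x^{T}A_ix-z\leq 0$, $i=1,\dots,m$. Suppose that $(x^*,z^* )=(0,0)$ is a local minimizer of this problem, and that the rank of the Jacobian matrix $J(x,z)=[\nabla_{x,z}\, g_1(x,z)\ \cdots\ \nabla_{x,z}\, g_m(x,z)]\in\mathbb{R}^{(n+1)\times m}$ increases at most by one in a neighborhood of $(x^*,z^* )$ with respect to its rank at $(x^*,z^* )$; that is, there is a neighborhood $U$ of $(0,0)$ such that $\operatorname{rank} J(x,z)\leq \operatorname{rank} J(0,0)+1$ for all $(x,z)\in U$. Then there exists $t\in\Lambda_m$ such that $\sum_{i=1}^m t_iA_i$ is positive semidefinite.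
   Context: $\nabla_{x,z}\,g_i(x,z)\in\mathbb{R}^{n+1}$ denotes the gradient of $g_i$ with respect to all variables $(x,z)$, written as a column vector. $\Lambda_m=\{t\in\mathbb{R}^m \mid t_i\ge 0 \text{ for all } i,\ \sum_{i=1}^m t_i=1\}$. *)

theory Defs
  imports "HOL-Analysis.Analysis"
begin

definition gradient :: "('a::real_inner \<Rightarrow> real) \<Rightarrow> 'a \<Rightarrow> 'a" where
  "gradient f p = (THE D. GDERIV f p :> D)"

lemma gradient_eqI:
  assumes "GDERIV f p :> D"
  shows "gradient f p = D"
  unfolding gradient_def
proof (rule the_equality)
  show "GDERIV f p :> D" by (fact assms)
next
  fix D' assume "GDERIV f p :> D'"
  then have "(\<lambda>h. h \<bullet> D') = (\<lambda>h. h \<bullet> D)"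
    using assms unfolding gderiv_def by (rule has_derivative_unique)
  then show "D' = D"
    by (metis vector_eq_ldot)
qed

(* The matrix whose i-th column is the gradient of g i with respect to (x, z).
   Rows are indexed by 'n option, of size n + 1: Some k is the coordinate x $ k
   and None is the coordinate z. *)
definition jacobian_columns ::
  "('m \<Rightarrow> (real^'n) \<times> real \<Rightarrow> real) \<Rightarrow> (real^'n) \<times> real \<Rightarrow> real^'m^('n option)" where
  "jacobian_columns g p =
     (\<chi> r i. case r of Some k \<Rightarrow> fst (gradient (g i) p) $ k | None \<Rightarrow> snd (gradient (g i) p))"

definition quad_epi :: "real^'n^'n \<Rightarrow> (real^'n) \<times> real \<Rightarrow> real" where
  "quad_epi M = (\<lambda>(x, z). 1/2 * (x \<bullet> (M *v x)) - z)"

lemma gradient_quad_epi: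
  fixes M :: "real^'n^'n"
  assumes "transpose M = M"
  shows "gradient (quad_epi M) (x, z) = (M *v x, -1)"
proof (rule gradient_eqI)
  have sym: "u \<bullet> (M *v v) = v \<bullet> (M *v u)" for u v :: "real^'n"
    by (metis assms dot_lmul_matrix inner_commute transpose_matrix_vector)
  have lin: "bounded_linear ((*v) M)"
    by (rule matrix_vector_mul_bounded_linear)
  have "((\<lambda>p. 1/2 * (fst p \<bullet> (M *v fst p)) - snd p) has_derivative
          (\<lambda>h. 1/2 * (x \<bullet> (M *v fst h) + fst h \<bullet> (M *v x)) - snd h)) (at (x, z))"
    by (auto intro!: derivative_eq_intros bounded_linear.has_derivative[OF lin])
  moreover have "(\<lambda>h. 1/2 * (x \<bullet> (M *v fst h) + fst h \<bullet> (M *v x)) - snd h) =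
      (\<lambda>h. h \<bullet> (M *v x, -1))"
    by (auto simp: fun_eq_iff inner_prod_def sym[of x])
  ultimately show "GDERIV (quad_epi M) (x, z) :> (M *v x, -1)"
    unfolding gderiv_def quad_epi_def by (simp add: case_prod_unfold)
qed

definition local_minimizer_on :: "('a::topological_space \<Rightarrow> real) \<Rightarrow> 'a set \<Rightarrow> 'a \<Rightarrow> bool" where
  "local_minimizer_on f S p \<longleftrightarrow>
     p \<in> S \<and> (\<exists>U. open U \<and> p \<in> U \<and> (\<forall>q \<in> U \<inter> S. f p \<le> f q))"

definition unit_simplex :: "(real^'m) set" where
  "unit_simplex = {t. (\<forall>i. 0 \<le> t $ i) \<and> (\<Sum>i\<in>UNIV. t $ i) = 1}"

definition pos_semidef :: "real^'n^'n \<Rightarrow> bool" where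
  "pos_semidef M \<longleftrightarrow> transpose M = M \<and> (\<forall>x. 0 \<le> x \<bullet> (M *v x))"

end

theory Submission
  imports Defs
begin

text \<open>
  The local minimality says that no \<open>x\<close> makes all forms \<open>x \<bullet> (A i *v x)\<close> negative.
  The Jacobian has rank 1 at the origin, so the rank condition says that for every \<open>x\<close> the
  vectors \<open>(A i - A k) *v x\<close> span at most a line. For symmetric matrices this forces all
  \<open>A i - A k\<close> to be multiples of a single matrix, hence the \<open>A i\<close> lie on a line and every
  form is bounded by the maximum of the two forms at the endpoints. The claim is then Yuan's
  lemma for two quadratic forms, which follows from two connectedness arguments.
\<close>

section \<open>Quadratic forms of symmetric matrices\<close>

lemma inner_symmetric_matrix:
  fixes M :: "real^'n^'n"
  assumes "transpose M = M"
  shows "u \<bullet> (M *v v) = v \<bullet> (M *v u)"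
  by (metis assms dot_lmul_matrix inner_commute transpose_matrix_vector)

lemma quadratic_form_add:
  fixes M :: "real^'n^'n"
  assumes "transpose M = M"
  shows "(a *\<^sub>R x + b *\<^sub>R y) \<bullet> (M *v (a *\<^sub>R x + b *\<^sub>R y)) =
    a\<^sup>2 * (x \<bullet> (M *v x)) + 2 * (a * b) * (x \<bullet> (M *v y)) + b\<^sup>2 * (y \<bullet> (M *v y))"
proof -
  have "y \<bullet> (M *v x) = x \<bullet> (M *v y)"
    using inner_symmetric_matrix[OF assms] .
  then show ?thesis
    by (simp add: matrix_vector_right_distrib matrix_vector_mult_scaleR inner_add_left
        inner_add_right power2_eq_square algebra_simps)
qed

text \<open>Polarization: in the expansion of the form at \<open>x + y\<close> only the cross term
  can survive, so it vanishes too.\<close>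

lemma symmetric_matrix_eq_zeroI:
  fixes M :: "real^'n^'n"
  assumes "transpose M = M" and "\<And>x. x \<bullet> (M *v x) = 0"
  shows "M = 0"
proof -
  have "x \<bullet> (M *v y) = 0" for x y
    using quadratic_form_add[OF assms(1), of 1 x 1 y] assms(2) by simp
  then have "M *v y = 0" for y
    by (metis inner_eq_zero_iff)
  then show ?thesis
    by (metis matrix_eq matrix_vector_mult_0)
qed

text \<open>Yuan's lemma. If every combination \<open>f t\<close> took a negative value,
  connectedness of \<open>{0..1}\<close> in \<open>t\<close> would give one \<open>t\<close> with
  two negative points of \<open>f t\<close>, one negative for \<open>p\<close> and one for
  \<open>q\<close>. Connectedness of a segment joining them then contradicts
  \<open>nonneg\<close>.\<close>

lemma pos_semidef_convex_combination_two:
  fixes P Q :: "real^'n^'n"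
  assumes P: "transpose P = P" and Q: "transpose Q = Q"
    and nonneg: "\<And>x. 0 \<le> x \<bullet> (P *v x) \<or> 0 \<le> x \<bullet> (Q *v x)"
  shows "\<exists>t\<in>{0..1}. \<forall>x. 0 \<le> (1 - t) * (x \<bullet> (P *v x)) + t * (x \<bullet> (Q *v x))"
proof (rule ccontr)
  define p where "p x = x \<bullet> (P *v x)" for x
  define q where "q x = x \<bullet> (Q *v x)" for x
  define f where "f t x = (1 - t) * p x + t * q x" for t x
  \<comment> \<open>\<open>T p\<close> and \<open>T q\<close> sort the parameters \<open>t\<close>
    by which of the two forms is negative at a witness of \<open>f t x < 0\<close>.\<close>
  define T where "T h = (\<Union>x\<in>{x. h x < 0}. {t. f t x < 0})" for h :: "real^'n \<Rightarrow> real"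
  assume "\<not> ?thesis"
  then have neg: "\<exists>x. f t x < 0" if "0 \<le> t" "t \<le> 1" for t
    using that by (auto simp: f_def p_def q_def not_le)
  have f_neg: "p x < 0 \<or> q x < 0" if "f t x < 0" "0 \<le> t" "t \<le> 1" for t x
  proof (rule ccontr)
    assume "\<not> (p x < 0 \<or> q x < 0)"
    with that have "0 \<le> (1 - t) * p x" "0 \<le> t * q x" by auto
    with that show False by (simp add: f_def)
  qed
  have not_both: "\<not> (p x < 0 \<and> q x < 0)" for x
    using nonneg[of x] by (auto simp: p_def q_def)
  have open_T: "open (T h)" for h
    unfolding T_def f_def by (intro open_UN ballI open_Collect_less continuous_intros)
  obtain x0 where "f 0 x0 < 0" using neg[of 0] by auto
  then have "0 \<in> T p" by (auto simp: T_def f_def)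
  obtain x1 where "f 1 x1 < 0" using neg[of 1] by auto
  then have "1 \<in> T q" by (auto simp: T_def f_def)
  have cover: "{0..1} \<subseteq> T p \<union> T q"
  proof
    fix t :: real assume "t \<in> {0..1}"
    then have t: "0 \<le> t" "t \<le> 1" by auto
    then obtain x where "f t x < 0" using neg by blast
    with f_neg[OF this t] show "t \<in> T p \<union> T q" by (auto simp: T_def)
  qed
  have "T p \<inter> T q \<inter> {0..1} \<noteq> {}"
    using connectedD[OF connected_Icc[of 0 "1::real"] open_T open_T _ cover]
      \<open>0 \<in> T p\<close> \<open>1 \<in> T q\<close> by force
  then obtain t where t: "0 \<le> t" "t \<le> 1" and "t \<in> T p" "t \<in> T q" by auto
  then obtain x y' where x: "p x < 0" "f t x < 0" and y': "q y' < 0" "f t y' < 0"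
    unfolding T_def by blast
  \<comment> \<open>\<open>c\<close> is the bilinear form of \<open>f t\<close>. Replacing
    \<open>y'\<close> by its negative flips the cross term \<open>c x y'\<close> but changes no
    quadratic form, so the cross term may be taken nonpositive and \<open>f t\<close> stays negative
    along the segment.\<close>
  define c where "c u v = (1 - t) * (u \<bullet> (P *v v)) + t * (u \<bullet> (Q *v v))" for u v
  define y where "y = (if c x y' \<le> 0 then y' else - y')"
  have minus: "P *v (- y') = - (P *v y')" "Q *v (- y') = - (Q *v y')"
    by (metis matrix_vector_mult_scaleR scaleR_minus1_left)+
  have y: "q y < 0" "f t y < 0"
    using y' minus by (auto simp: y_def p_def q_def f_def)
  have c: "c x y \<le> 0"
    by (auto simp: y_def c_def minus algebra_simps)
  define w where "w s = (1 - s) *\<^sub>R x + s *\<^sub>R y" for s :: real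
  have w: "p (w s) = (1 - s)\<^sup>2 * p x + 2 * ((1 - s) * s) * (x \<bullet> (P *v y)) + s\<^sup>2 * p y"
    "q (w s) = (1 - s)\<^sup>2 * q x + 2 * ((1 - s) * s) * (x \<bullet> (Q *v y)) + s\<^sup>2 * q y" for s
    unfolding w_def p_def q_def
    using quadratic_form_add[OF P] quadratic_form_add[OF Q] by auto
  have f_w: "f t (w s) < 0" if s: "0 \<le> s" "s \<le> 1" for s
  proof -
    have eq: "f t (w s) = (1 - s)\<^sup>2 * f t x + 2 * ((1 - s) * s) * c x y + s\<^sup>2 * f t y"
      unfolding f_def w c_def by (simp add: algebra_simps)
    have "2 * ((1 - s) * s) * c x y \<le> 0"
      using s c by (intro mult_nonneg_nonpos) auto
    moreover have "(1 - s)\<^sup>2 * f t x + s\<^sup>2 * f t y < 0"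
    proof (cases "s = 0")
      case True
      then show ?thesis using x by simp
    next
      case False
      then have "s\<^sup>2 * f t y < 0" using y by (simp add: mult_pos_neg)
      moreover have "(1 - s)\<^sup>2 * f t x \<le> 0" using x by (simp add: mult_nonneg_nonpos)
      ultimately show ?thesis by simp
    qed
    ultimately show ?thesis unfolding eq by linarith
  qed
  \<comment> \<open>Along the segment the two negativity sets are open, cover \<open>{0..1}\<close>,
    are disjoint there, and contain 0 and 1 respectively.\<close>
  have open_w: "open {s. p (w s) < 0}" "open {s. q (w s) < 0}"
    unfolding w by (intro open_Collect_less continuous_intros)+
  have "{0..1} \<subseteq> {s. p (w s) < 0} \<union> {s. q (w s) < 0}"
    using f_neg[OF f_w t] by fastforce
  moreover have "0 \<in> {s. p (w s) < 0}" "1 \<in> {s. q (w s) < 0}"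
    using x y by (auto simp: w_def)
  moreover have "{s. p (w s) < 0} \<inter> {s. q (w s) < 0} \<inter> {0..1} = {}"
    using not_both by auto
  ultimately show False
    using connectedD[OF connected_Icc[of 0 "1::real"] open_w] by force
qed

text \<open>Pointwise factors agree with the factor \<open>c\<close> at one \<open>x0\<close> with
  nonzero form: \<open>D = C - c *\<^sub>R B\<close> kills \<open>x0\<close>, so by symmetry its
  range is orthogonal to \<open>x0\<close>. Where \<open>D *v y\<close> is a multiple of a vector
  not orthogonal to \<open>x0\<close>, it must vanish.\<close>

lemma symmetric_matrices_parallel:
  fixes B C :: "real^'n^'n"
  assumes B: "transpose B = B" "B \<noteq> 0" and C: "transpose C = C"
    and dep: "\<And>x. B *v x = 0 \<or> (\<exists>k. C *v x = k *\<^sub>R (B *v x))"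
  shows "\<exists>c. C = c *\<^sub>R B"
proof -
  obtain x0 where x0: "x0 \<bullet> (B *v x0) \<noteq> 0"
    using symmetric_matrix_eq_zeroI[OF B(1)] B(2) by blast
  then obtain c where c: "C *v x0 = c *\<^sub>R (B *v x0)"
    using dep[of x0] by auto
  define D where "D = C - c *\<^sub>R B"
  have D: "D *v x = C *v x - c *\<^sub>R (B *v x)" for x
    by (simp add: D_def matrix_vector_mult_diff_rdistrib scaleR_matrix_vector_assoc)
  have sym: "u \<bullet> (D *v v) = v \<bullet> (D *v u)" for u v
    using inner_symmetric_matrix[OF B(1)] inner_symmetric_matrix[OF C]
    by (simp add: D inner_diff_right)
  have D0: "D *v x0 = 0" by (simp add: D c)
  have *: "D *v y = 0" if nz: "x0 \<bullet> (B *v (x0 + y)) \<noteq> 0" for y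
  proof -
    obtain k where "C *v (x0 + y) = k *\<^sub>R (B *v (x0 + y))"
      using dep[of "x0 + y"] nz by auto
    then have eq: "D *v y = (k - c) *\<^sub>R (B *v (x0 + y))"
      using D[of "x0 + y"] D0 by (simp add: matrix_vector_right_distrib scaleR_left_diff_distrib)
    moreover have "x0 \<bullet> (D *v y) = 0"
      using sym[of x0 y] D0 by simp
    ultimately show ?thesis using nz by simp
  qed
  have "D *v y = 0" for y
  proof (cases "x0 \<bullet> (B *v (x0 + y)) = 0")
    case True
    \<comment> \<open>In the exceptional case \<open>x0 \<bullet> (B *v y)\<close> is the negative
      of \<open>x0 \<bullet> (B *v x0)\<close>, so doubling \<open>y\<close> leaves the exceptional
      set.\<close>
    then have "x0 \<bullet> (B *v (x0 + 2 *\<^sub>R y)) \<noteq> 0"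
      using x0 by (simp add: matrix_vector_right_distrib matrix_vector_mult_scaleR inner_add_right)
    from *[OF this] show ?thesis by (simp add: matrix_vector_mult_scaleR)
  qed (use * in blast)
  then have "D = 0" by (metis matrix_eq matrix_vector_mult_0)
  then show ?thesis by (auto simp: D_def)
qed

text \<open>Coordinate \<open>r\<close> keeps \<open>p\<close> out of the span of \<open>b\<close>
  and \<open>c\<close>. Were these two independent, the span of \<open>S\<close> would contain three
  independent vectors.\<close>

lemma parallel_if_dim_le_2:
  fixes p b c :: "real^'k"
  assumes S: "dim S \<le> 2" "p \<in> S" "p + b \<in> S" "p + c \<in> S"
    and coord: "p $ r \<noteq> 0" "b $ r = 0" "c $ r = 0"
  shows "b = 0 \<or> (\<exists>k. c = k *\<^sub>R b)"
proof (rule ccontr)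
  assume neg: "\<not> ?thesis"
  then have "independent {c, b}"
    by (subst independent_insert) (auto simp: span_singleton)
  moreover have "b \<noteq> 0" using neg by auto
  moreover have "p \<notin> span {c, b}"
  proof
    assume "p \<in> span {c, b}"
    then obtain k l where "p = k *\<^sub>R c + l *\<^sub>R b"
      by (auto simp: span_insert algebra_simps)
    with coord show False by simp
  qed
  ultimately have ind: "independent {p, c, b}"
    by (simp add: independent_insert)
  have "c \<noteq> b" using neg by (metis scaleR_one)
  moreover have "p \<noteq> c" "p \<noteq> b" using coord by auto
  ultimately have "card {p, c, b} = 3" by simp
  moreover have "{p, c, b} \<subseteq> span S"
    using S(2-) by (auto intro: span_base) (metis add_diff_cancel_left' span_base span_diff)+
  then have "card {p, c, b} \<le> dim (span S)"
    using ind by (intro independent_card_le_dim)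
  ultimately show False using S(1) by (simp add: dim_span)
qed

section \<open>Consequences of the rank condition\<close>

lemma column_jacobian_columns:
  "column i (jacobian_columns g p) =
    (\<chi> r. case r of Some k \<Rightarrow> fst (gradient (g i) p) $ k | None \<Rightarrow> snd (gradient (g i) p))"
  by (simp add: column_def jacobian_columns_def vec_eq_iff)

text \<open>At the origin every gradient is \<open>(0, -1)\<close>, so all columns coincide.\<close>

lemma rank_jacobian_columns_0_le:
  fixes A :: "'m::finite \<Rightarrow> real^'n^'n"
  assumes "\<And>i. transpose (A i) = A i"
  shows "rank (jacobian_columns (\<lambda>i. quad_epi (A i)) (0, 0)) \<le> 1"
proof -
  let ?J = "jacobian_columns (\<lambda>i. quad_epi (A i)) (0, 0)"
  have "column i ?J = column j ?J" for i j
    by (simp add: column_jacobian_columns gradient_quad_epi[OF assms] cong: option.case_cong)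
  then have "columns ?J \<subseteq> {column undefined ?J}"
    by (auto simp: columns_def)
  then have "dim (columns ?J) \<le> card {column undefined ?J}"
    by (intro dim_le_card) (auto intro: span_base)
  then show ?thesis by (simp add: column_rank_def)
qed

text \<open>The columns are the vectors \<open>(A i *v x, -1)\<close>: their differences vanish in
  coordinate \<open>None\<close>, while column \<open>k\<close> does not.\<close>

lemma differences_parallel_if_rank_le_2:
  fixes A :: "'m::finite \<Rightarrow> real^'n^'n"
  assumes A: "\<And>i. transpose (A i) = A i"
    and rank: "rank (jacobian_columns (\<lambda>i. quad_epi (A i)) (x, z)) \<le> 2"
  shows "(A j - A k) *v x = 0 \<or> (\<exists>c. (A i - A k) *v x = c *\<^sub>R ((A j - A k) *v x))"
proof -
  let ?J = "jacobian_columns (\<lambda>i. quad_epi (A i)) (x, z)"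
  \<comment> \<open>\<open>e\<close> embeds the \<open>x\<close>-space as the vectors with zero
    \<open>z\<close>-coordinate.\<close>
  define e where "e v = (\<chi> r. case r of Some l \<Rightarrow> v $ l | None \<Rightarrow> 0)" for v :: "real^'n"
  have e_inj: "v = w" if "e v = e w" for v w
    using that by (auto simp: e_def vec_eq_iff dest: spec[of _ "Some _"])
  have e_scale: "c *\<^sub>R e v = e (c *\<^sub>R v)" for c v
    by (auto simp: e_def vec_eq_iff split: option.split)
  have e0: "e 0 = 0"
    by (auto simp: e_def vec_eq_iff split: option.split)
  have col: "column k ?J + e ((A l - A k) *v x) = column l ?J" for l
    by (auto simp: column_jacobian_columns gradient_quad_epi A e_def vec_eq_iff
        matrix_vector_mult_diff_rdistrib split: option.split)
  have "e ((A j - A k) *v x) = 0 \<or>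
      (\<exists>c. e ((A i - A k) *v x) = c *\<^sub>R e ((A j - A k) *v x))"
  proof (rule parallel_if_dim_le_2)
    show "dim (columns ?J) \<le> 2" using rank by (simp add: column_rank_def)
    show "column k ?J $ None \<noteq> 0"
      by (simp add: column_jacobian_columns gradient_quad_epi A)
    show "column k ?J \<in> columns ?J" "column k ?J + e ((A j - A k) *v x) \<in> columns ?J"
      "column k ?J + e ((A i - A k) *v x) \<in> columns ?J"
      unfolding col by (auto simp: columns_def)
  qed (auto simp: e_def)
  then show ?thesis
    using e_inj e_scale e0 by metis
qed

section \<open>Consequences of local minimality\<close>

lemma ex_pos_scaleR_mem_open:
  fixes U :: "('a::real_normed_vector \<times> real) set"
  assumes "open U" "(0, 0) \<in> U"
  shows "\<exists>e>0. (e *\<^sub>R x, e\<^sup>2 * z) \<in> U"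
proof -
  have "((\<lambda>e. (e *\<^sub>R x, e\<^sup>2 * z)) \<longlongrightarrow> (0 *\<^sub>R x, 0\<^sup>2 * z)) (at_right 0)"
    by (intro tendsto_intros)
  then have "eventually (\<lambda>e. (e *\<^sub>R x, e\<^sup>2 * z) \<in> U) (at_right 0)"
    using assms by (intro topological_tendstoD) auto
  then have "eventually (\<lambda>e. (e *\<^sub>R x, e\<^sup>2 * z) \<in> U \<and> 0 < e) (at_right 0)"
    by (intro eventually_conj) (auto simp: eventually_at_right_less)
  then show ?thesis
    using eventually_happens'[OF trivial_limit_at_right_real] by blast
qed

text \<open>If all forms were negative at \<open>x\<close>, the least \<open>z\<close> feasible for
  \<open>x\<close> would be negative. Scaling \<open>x\<close> by \<open>e\<close> and
  \<open>z\<close> by \<open>e\<^sup>2\<close> multiplies each constraint by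
  \<open>e\<^sup>2\<close>, which moves this point arbitrarily close to the origin and keeps it
  feasible.\<close>

lemma local_minimizer_forms_not_all_neg:
  fixes A :: "'m::finite \<Rightarrow> real^'n^'n"
  assumes "local_minimizer_on (\<lambda>(x, z). z) {p. \<forall>i. quad_epi (A i) p \<le> 0} (0, 0)"
  shows "\<exists>i. 0 \<le> x \<bullet> (A i *v x)"
proof (rule ccontr)
  assume "\<not> ?thesis"
  then have neg: "x \<bullet> (A i *v x) < 0" for i by (auto simp: not_le)
  define z where "z = Max (range (\<lambda>i. 1/2 * (x \<bullet> (A i *v x))))"
  have "z \<in> range (\<lambda>i. 1/2 * (x \<bullet> (A i *v x)))"
    unfolding z_def by (intro Max_in) auto
  then have "z < 0" using neg by auto
  have z: "1/2 * (x \<bullet> (A i *v x)) \<le> z" for i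
    unfolding z_def by (intro Max_ge) auto
  obtain U where U: "open U" "(0, 0) \<in> U"
    and U_min: "\<forall>q \<in> U \<inter> {p. \<forall>i. quad_epi (A i) p \<le> 0}. 0 \<le> snd q"
    using assms unfolding local_minimizer_on_def by (auto simp: case_prod_beta)
  obtain e :: real where e: "e > 0" "(e *\<^sub>R x, e\<^sup>2 * z) \<in> U"
    using ex_pos_scaleR_mem_open[OF U] by blast
  have "quad_epi (A i) (e *\<^sub>R x, e\<^sup>2 * z) = e\<^sup>2 * (1/2 * (x \<bullet> (A i *v x)) - z)" for i
    by (simp add: quad_epi_def matrix_vector_mult_scaleR power2_eq_square algebra_simps)
  then have "quad_epi (A i) (e *\<^sub>R x, e\<^sup>2 * z) \<le> 0" for i
    using z[of i] by (simp add: mult_nonneg_nonpos)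
  then have "0 \<le> e\<^sup>2 * z" using bspec[OF U_min, of "(e *\<^sub>R x, e\<^sup>2 * z)"] e by simp
  with e \<open>z < 0\<close> show False by (simp add: zero_le_mult_iff)
qed

lemma transpose_diff_symmetric:
  fixes P Q :: "real^'n^'n"
  assumes "transpose P = P" "transpose Q = Q"
  shows "transpose (P - Q) = P - Q"
  using assms by (simp add: transpose_def vec_eq_iff)

theorem theorem3:
  fixes A :: "'m::finite \<Rightarrow> real^'n^'n"
    and g :: "'m \<Rightarrow> (real^'n) \<times> real \<Rightarrow> real"
    and J :: "(real^'n) \<times> real \<Rightarrow> real^'m^('n option)"
  defines "g \<equiv> \<lambda>i. quad_epi (A i)"
    and "J \<equiv> jacobian_columns g"
  assumes "\<And>i. transpose (A i) = A i"
    and "local_minimizer_on (\<lambda>(x, z). z) {p. \<forall>i. g i p \<le> 0} (0, 0)"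
    and "\<exists>U. open U \<and> (0, 0) \<in> U \<and> (\<forall>p\<in>U. rank (J p) \<le> rank (J (0, 0)) + 1)"
  shows "\<exists>t\<in>unit_simplex. pos_semidef (\<Sum>i\<in>UNIV. t $ i *\<^sub>R A i)"
proof -
  note sym = assms(3)
  have some_nonneg: "\<exists>i. 0 \<le> x \<bullet> (A i *v x)" for x
    using local_minimizer_forms_not_all_neg assms(4) unfolding g_def .
  obtain U where U: "open U" "(0, 0) \<in> U" "\<And>p. p \<in> U \<Longrightarrow> rank (J p) \<le> 2"
    using assms(5) rank_jacobian_columns_0_le[of A, OF sym] unfolding J_def g_def by force
  \<comment> \<open>The rank bound holds only in \<open>U\<close>, but the dependence is homogeneous
    in \<open>x\<close>, so \<open>x\<close> can first be scaled into \<open>U\<close>.\<close>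
  have dep: "(A j - A k) *v x = 0 \<or> (\<exists>c. (A i - A k) *v x = c *\<^sub>R ((A j - A k) *v x))"
    for i j k x
  proof -
    obtain e :: real where e: "e > 0" "(e *\<^sub>R x, e\<^sup>2 * 0) \<in> U"
      using ex_pos_scaleR_mem_open[OF U(1,2)] by blast
    have "rank (J (e *\<^sub>R x, e\<^sup>2 * 0)) \<le> 2" using U(3) e by blast
    from differences_parallel_if_rank_le_2[OF sym this[unfolded J_def g_def], of j k i]
    show ?thesis
      using e(1) unfolding matrix_vector_mult_scaleR scaleR_left_commute[of _ e]
      by (simp del: scaleR_scaleR)
  qed
  have "\<exists>B s. \<forall>i. A i = A k + s i *\<^sub>R B" for k
  proof (cases "\<exists>j. A j \<noteq> A k")
    case True
    then obtain j where "A j \<noteq> A k" ..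
    then have "\<exists>c. A i - A k = c *\<^sub>R (A j - A k)" for i
      by (intro symmetric_matrices_parallel transpose_diff_symmetric sym dep) simp
    then obtain s where "A i - A k = s i *\<^sub>R (A j - A k)" for i by metis
    then show ?thesis by (metis add.commute diff_add_cancel)
  qed (auto intro!: exI[of _ 0])
  then obtain k B and s :: "'m \<Rightarrow> real" where AB: "A i = A k + s i *\<^sub>R B" for i by metis
  have form: "x \<bullet> (A i *v x) = x \<bullet> (A k *v x) + s i * (x \<bullet> (B *v x))" for i x
    by (subst AB) (simp add: matrix_vector_mult_add_rdistrib inner_add_right
        scaleR_matrix_vector_assoc[symmetric])
  \<comment> \<open>At fixed \<open>x\<close> the form of \<open>A l\<close> is affine in
    \<open>s l\<close>, so it is at most the larger of its values at the extreme parameters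
    \<open>s i\<close> and \<open>s j\<close>.\<close>
  obtain i where i: "s i \<le> s l" for l
    using ex_min_if_finite[of "range s"] by (auto simp: not_less)
  obtain j where j: "s l \<le> s j" for l
    using ex_min_if_finite[of "range (\<lambda>l. - s l)"] by (auto simp: not_less)
  have "0 \<le> x \<bullet> (A i *v x) \<or> 0 \<le> x \<bullet> (A j *v x)" for x
  proof -
    obtain l where "0 \<le> x \<bullet> (A l *v x)" using some_nonneg by blast
    moreover have "s l * (x \<bullet> (B *v x)) \<le> s i * (x \<bullet> (B *v x)) \<or>
        s l * (x \<bullet> (B *v x)) \<le> s j * (x \<bullet> (B *v x))"
      using i[of l] j[of l] by (meson le_cases mult_right_mono mult_right_mono_neg)
    ultimately show ?thesis unfolding form[of x i] form[of x j] form[of x l] by linarith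
  qed
  from pos_semidef_convex_combination_two[OF sym sym this]
  obtain r where r: "0 \<le> r" "r \<le> 1"
    and psd: "\<And>x. 0 \<le> (1 - r) * (x \<bullet> (A i *v x)) + r * (x \<bullet> (A j *v x))" by auto
  define t :: "real^'m" where "t = (1 - r) *\<^sub>R axis i 1 + r *\<^sub>R axis j 1"
  \<comment> \<open>Two separate summands also cover \<open>i = j\<close>, where the weights add up
    to 1.\<close>
  have t: "t $ l = (if l = i then 1 - r else 0) + (if l = j then r else 0)" for l
    by (simp add: t_def axis_def)
  have "t \<in> unit_simplex"
    using r by (simp add: unit_simplex_def t sum.distrib)
  moreover have "(\<Sum>l\<in>UNIV. t $ l *\<^sub>R A l) = (1 - r) *\<^sub>R A i + r *\<^sub>R A j"
    by (simp add: t scaleR_left_distrib sum.distrib if_distrib[of "\<lambda>c. c *\<^sub>R _"] cong: if_cong)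
  moreover have "pos_semidef ((1 - r) *\<^sub>R A i + r *\<^sub>R A j)"
    unfolding pos_semidef_def
  proof (intro conjI allI)
    show "transpose ((1 - r) *\<^sub>R A i + r *\<^sub>R A j) = (1 - r) *\<^sub>R A i + r *\<^sub>R A j"
      using sym[of i] sym[of j] by (simp add: transpose_def vec_eq_iff)
    show "0 \<le> x \<bullet> (((1 - r) *\<^sub>R A i + r *\<^sub>R A j) *v x)" for x
      using psd[of x] by (simp add: matrix_vector_mult_add_rdistrib inner_add_right
          scaleR_matrix_vector_assoc[symmetric])
  qed
  ultimately show ?thesis by metis
qed

end
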